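(* Let $1\le M<N$, and let $p_H$ be a probability distribution on $\mathbb{R}^N$ (the prior distribution of the CSI $\mathbf{H}$, regarded as a real vector). Consider the following: (i) an invertible neural network $f(\cdot;\theta):\mathbb{R}^N\to\mathbb{R}^M\times\mathbb{R}^{N-M}$, $f(\mathbf{H};\theta)=[\mathbf{z},\mathbf{r}]=[f_{\mathbf{z}}(\mathbf{H};\theta),f_{\mathbf{r}}(\mathbf{H};\theta)]$, with inverse $g(\cdot;\theta)=f^{-1}(\cdot;\theta)$; (ii) a differentiable adaptive quantization (DAQ) module $\mathbf{v}=\Lambda^{\mathrm{DAQ}}(\mathbf{z};\Theta^{\mathrm{DAQ}})$ with quantization point matrix $\bar{\mathbf{V}}=\Lambda^{\mathrm{QP}}(\Theta^{\mathrm{DAQ}})$; (iii) a differentiable bit-channel distortion (D-BCD) module $\hat{\mathbf{v}}=\Omega(\mathbf{v},\bar{\mathbf{V}})$; (iv) a denoising network $\hat{\mathbf{z}}=\Psi(\hat{\mathbf{v}};\Theta^{D})$ with values in $\mathbb{R}^M$; (v) a learnable Gaussian distribution $\upsilon_R=\mathcal{N}(\boldsymbol{\mu},\sigma^2\mathbf{I})$ on $\mathbb{R}^{N-M}$ for the auxiliary variable. Let $q(\mathbf{z},\mathbf{r})$ be the joint distribution of $(f_{\mathbf{z}}(\mathbf{H};\theta),f_{\mathbf{r}}(\mathbf{H};\theta))$ when $\mathbf{H}\sim p_H$, and let $p(\hat{\mathbf{z}})$ be the distribution of $\hat{\mathbf{z}}=\Psi\big(\Omega\big(\Lambda^{\mathrm{DAQ}}(f_{\mathbf{z}}(\mathbf{H};\theta)),\bar{\mathbf{V}}\big)\big)$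 when $\mathbf{H}\sim p_H$. Suppose that these components are jointly trained so that the loss $$\mathcal{L}_{\mathbf{r}}=\mathrm{MMD}^2\big(q(\mathbf{z},\mathbf{r}),\,p(\hat{\mathbf{z}})\,\upsilon_R(\mathbf{r})\big)$$ equals zero, where $p(\hat{\mathbf{z}})\,\upsilon_R(\mathbf{r})$ denotes the product distribution on $\mathbb{R}^M\times\mathbb{R}^{N-M}$. Let $\hat{\mathbf{z}}=\Psi\big(\Omega\big(\Lambda^{\mathrm{DAQ}}(f_{\mathbf{z}}(\mathbf{H};\theta)),\bar{\mathbf{V}}\big)\big)$ with $\mathbf{H}\sim p_H$, let $\mathbf{r}\sim\upsilon_R$ be sampled independently of $\hat{\mathbf{z}}$, and let $\widehat{\mathbf{H}}=g(\hat{\mathbf{z}},\mathbf{r};\theta)$ be the reconstructed sample. Then the marginal distribution $q(\mathbf{H})$ of $\widehat{\mathbf{H}}$ matches the true distribution $p_H$, i.e. $$\mathrm{MMD}^2\big(q(\mathbf{H}),p_H(\mathbf{H})\big)=0 .$$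
   Context: Invertible neural network (INN): a bijection $f(\cdot;\theta):\mathbb{R}^N\to\mathbb{R}^M\times\mathbb{R}^{N-M}$ with parameters $\theta$, obtained by composing finitely many invertible blocks (possibly with coordinate permutations between them, and preceded by a fixed invertible linear transformation of the input). The input of a block is split as $[\mathbf{H}_1^i,\mathbf{H}_2^i]\in\mathbb{R}^M\times\mathbb{R}^{N-M}$ and the block outputs $\mathbf{H}_1^{i+1}=\mathbf{H}_1^i+\phi(\mathbf{H}_2^i)$, $\mathbf{H}_2^{i+1}=\mathbf{H}_2^i\odot\exp[\rho(\mathbf{H}_1^{i+1})]+\eta(\mathbf{H}_1^{i+1})$, where $\odot$ and $\exp$ are elementwise and $\phi,\rho,\eta$ are arbitrary ordinary neural networks (continuous functions, not required to be invertible) of matching dimensions, which may differ from block to block. Thus $f$ and $g=f^{-1}$ are both continuous. DAQ module: let $B\ge1$ be the number of bits per feature dimension and $Q=2^B$. With parameters $\Theta^{\mathrm{DAQ}}=\{a_{q,i},b_{q,i},c_i\}_{1\le q\le Q-1,\,1\le i\le M}$ satisfying $a_{q,i}\ge0$ and $b_{1,i}\le\dots\le b_{Q-1,i}$, and $\hat\epsilon(x)=\frac{Tx}{1+|Tx|}$ for a fixed $T>0$, the map $\Lambda^{\mathrm{DAQ}}:\mathbb{R}^M\to\mathbb{R}^M$ acts coordinatewise by $v_i=c_i+\sum_{q=1}^{Q-1}a_{q,i}\,\hat\epsilon(z_i-b_{q,i})$. The matrix $\bar{\mathbf{V}}=\Lambda^{\mathrm{QP}}(\Theta^{\mathrm{DAQ}})=[\bar{\mathbf{v}}_1,\dots,\bar{\mathbf{v}}_M]\in\mathbb{R}^{Q\times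 M}$ has entries $\bar v_i^{(1)}=c_i-\sum_{q=1}^{Q-1}a_{q,i}$ and $\bar v_i^{(q)}=\bar v_i^{(q-1)}+2a_{q-1,i}$ for $2\le q\le Q$. D-BCD module: $\Omega$ is a random map acting separately on each of the $M$ coordinates. For one coordinate with input $v\in\mathbb{R}$ and quantization points $\bar{\mathbf{v}}=[\bar v^{(1)},\dots,\bar v^{(Q)}]^T$, put $w_q=\exp(-|v-\bar v^{(q)}|/\beta)\big/\sum_{i=1}^Q\exp(-|v-\bar v^{(i)}|/\beta)$ with fixed $\beta>0$, and $\boldsymbol{\pi}=\mathbf{P}\mathbf{w}$, where $\mathbf{P}\in[0,1]^{Q\times Q}$ is a fixed channel transition probability matrix whose entry $p_{ij}$ is the probability that point $i$ is detected when point $j$ is transmitted (so its columns sum to 1). With i.i.d. Gumbel noises $g_j=-\log(-\log u_j)$, $u_j\sim\mathrm{Uniform}(0,1)$, and temperature $\tau>0$, put $\hat\pi_j=\exp((\log\pi_j+g_j)/\tau)\big/\sum_{i=1}^Q\exp((\log\pi_i+g_i)/\tau)$; the output is $\hat v=\bar{\mathbf{v}}^T\hat{\boldsymbol{\pi}}$. The Gumbel noises are independent of $\mathbf{H}$. Denoising network: $\Psi(\cdot;\Theta^D):\mathbb{R}^M\to\mathbb{R}^M$ is a neural network (a convolutional network with a residual connection; a continuous function) with parameters $\Theta^D$. Maximum mean discrepancy (MMD): for probability distributions $P,Q$ on the same Euclidean space and a kernel $K$ on that space, $\mathrm{MMD}^2(P,Q)=\mathbb{E}[K(X,X')]+\mathbb{E}[K(Y,Y')]-2\,\mathbb{E}[K(X,Y)]$,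 where $X,X'\sim P$ and $Y,Y'\sim Q$ are all independent. The base kernel is the inverse multiquadric kernel $k(\mathbf{x},\mathbf{y})=\frac{C}{C+\|\mathbf{x}-\mathbf{y}\|_2^2}$ with a constant $C>0$. For distributions of pairs in $\mathbb{R}^M\times\mathbb{R}^{N-M}$ the kernel is $K((\mathbf{z},\mathbf{r}),(\mathbf{z}',\mathbf{r}'))=k(\mathbf{z},\mathbf{z}')\,k(\mathbf{r},\mathbf{r}')$; for distributions on $\mathbb{R}^N$ (distributions of $\mathbf{H}$) the kernel is $K=k$. *)

theory Defs
  imports "HOL-Probability.Probability"
begin

section \<open>Invertible neural networks\<close>

text \<open>
  \<open>\<real>\<^sup>M\<close> and \<open>\<real>\<^sup>N\<^sup>-\<^sup>M\<close> are rendered as \<^typ>\<open>real ^ 'm\<close> and \<^typ>\<open>real ^ 'r\<close>,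
  so \<open>\<real>\<^sup>N\<close> is \<^typ>\<open>real ^ ('m + 'r)\<close>.  Finite types are nonempty,
  hence \<open>1 \<le> M < N\<close> always holds.
\<close>

definition split_vec :: "real ^ ('m::finite + 'r::finite) \<Rightarrow> (real ^ 'm) \<times> (real ^ 'r)" where
  "split_vec x = (\<chi> i. x $ Inl i, \<chi> j. x $ Inr j)"

definition join_vec :: "(real ^ 'm::finite) \<times> (real ^ 'r::finite) \<Rightarrow> real ^ ('m + 'r)" where
  "join_vec p = (\<chi> k. case k of Inl i \<Rightarrow> fst p $ i | Inr j \<Rightarrow> snd p $ j)"

definition permute_vec :: "('n \<Rightarrow> 'n) \<Rightarrow> real ^ 'n::finite \<Rightarrow> real ^ 'n" where
  "permute_vec s x = (\<chi> k. x $ s k)"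

definition inn_block ::
  "(real ^ 'r \<Rightarrow> real ^ 'm) \<Rightarrow> (real ^ 'm \<Rightarrow> real ^ 'r) \<Rightarrow> (real ^ 'm \<Rightarrow> real ^ 'r)
     \<Rightarrow> (real ^ 'm::finite) \<times> (real ^ 'r::finite) \<Rightarrow> (real ^ 'm) \<times> (real ^ 'r)" where
  "inn_block \<phi> \<rho> \<eta> = (\<lambda>(h1, h2).
     let h1' = h1 + \<phi> h2
     in (h1', \<chi> j. h2 $ j * exp (\<rho> h1' $ j) + \<eta> h1' $ j))"

text \<open>
  The subnetworks of a block are arbitrary continuous functions.  Every block is preceded by a
  coordinate permutation of \<open>\<real>\<^sup>N\<close>; taking it (or the initial linear map) to be the identity
  covers architectures without one.
\<close>

inductive inn :: "(real ^ ('m::finite + 'r::finite) \<Rightarrow> (real ^ 'm) \<times> (real ^ 'r)) \<Rightarrow> bool" where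
  linear: "linear A \<Longrightarrow> bij A \<Longrightarrow> inn (split_vec \<circ> A)"
| block: "inn F \<Longrightarrow> bij s \<Longrightarrow>
    continuous_on UNIV \<phi> \<Longrightarrow> continuous_on UNIV \<rho> \<Longrightarrow> continuous_on UNIV \<eta> \<Longrightarrow>
    inn (inn_block \<phi> \<rho> \<eta> \<circ> split_vec \<circ> permute_vec s \<circ> join_vec \<circ> F)"

lemma bij_split_vec: "bij split_vec"
  by (rule o_bij[of join_vec])
     (auto simp: fun_eq_iff split_vec_def join_vec_def vec_eq_iff split: sum.split)

lemma bij_join_vec: "bij join_vec"
  by (rule o_bij[of split_vec])
     (auto simp: fun_eq_iff split_vec_def join_vec_def vec_eq_iff split: sum.split)

lemma bij_permute_vec: "bij s \<Longrightarrow> bij (permute_vec s)"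
  by (rule o_bij[of "permute_vec (inv s)"])
     (auto simp: fun_eq_iff permute_vec_def vec_eq_iff bij_is_surj surj_f_inv_f bij_is_inj)

lemma bij_inn_block: "bij (inn_block \<phi> \<rho> \<eta>)"
  by (rule o_bij[of "\<lambda>(y1, y2). let h2 = (\<chi> j. (y2 $ j - \<eta> y1 $ j) / exp (\<rho> y1 $ j))
        in (y1 - \<phi> h2, h2)"])
     (auto simp: fun_eq_iff inn_block_def Let_def vec_eq_iff)

lemma inn_bij: "inn f \<Longrightarrow> bij f"
  by (induction rule: inn.induct)
     (intro bij_comp bij_split_vec bij_join_vec bij_permute_vec bij_inn_block; assumption)+


section \<open>Differentiable adaptive quantization\<close>

definition soft_sign :: "real \<Rightarrow> real \<Rightarrow> real" where
  "soft_sign T x = T * x / (1 + \<bar>T * x\<bar>)"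

definition daq ::
  "real \<Rightarrow> nat \<Rightarrow> (nat \<Rightarrow> real ^ 'm) \<Rightarrow> (nat \<Rightarrow> real ^ 'm) \<Rightarrow> real ^ 'm
     \<Rightarrow> real ^ 'm::finite \<Rightarrow> real ^ 'm" where
  "daq T Q a b c z = (\<chi> i. c $ i + (\<Sum>q = 1..Q - 1. a q $ i * soft_sign T (z $ i - b q $ i)))"

text \<open>Quantization points are indexed by \<open>1..Q\<close>; the value at index \<open>0\<close> is never used.\<close>

fun quant_points :: "nat \<Rightarrow> (nat \<Rightarrow> real ^ 'm) \<Rightarrow> real ^ 'm \<Rightarrow> nat \<Rightarrow> real ^ 'm::finite" where
  "quant_points Q a c 0 = 0"
| "quant_points Q a c (Suc 0) = c - (\<Sum>q = 1..Q - 1. a q)"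
| "quant_points Q a c (Suc (Suc q)) = quant_points Q a c (Suc q) + 2 *\<^sub>R a (Suc q)"


section \<open>Differentiable bit-channel distortion\<close>

definition soft_assign :: "real \<Rightarrow> nat \<Rightarrow> (nat \<Rightarrow> real) \<Rightarrow> real \<Rightarrow> nat \<Rightarrow> real" where
  "soft_assign \<beta> Q vb v q =
     exp (- \<bar>v - vb q\<bar> / \<beta>) / (\<Sum>i = 1..Q. exp (- \<bar>v - vb i\<bar> / \<beta>))"

text \<open>\<open>P i j\<close> is the probability that point \<open>i\<close> is detected when point \<open>j\<close> is transmitted.\<close>

definition channel_matrix :: "nat \<Rightarrow> (nat \<Rightarrow> nat \<Rightarrow> real) \<Rightarrow> bool" where
  "channel_matrix Q P \<longleftrightarrow>
     (\<forall>i\<in>{1..Q}. \<forall>j\<in>{1..Q}. 0 \<le> P i j \<and> P i j \<le> 1) \<and>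
     (\<forall>j\<in>{1..Q}. (\<Sum>i = 1..Q. P i j) = 1)"

definition detect_prob :: "nat \<Rightarrow> (nat \<Rightarrow> nat \<Rightarrow> real) \<Rightarrow> (nat \<Rightarrow> real) \<Rightarrow> nat \<Rightarrow> real" where
  "detect_prob Q P w i = (\<Sum>j = 1..Q. P i j * w j)"

definition gumbel :: "real \<Rightarrow> real" where
  "gumbel u = - ln (- ln u)"

text \<open>
  A vanishing probability has logarithm \<open>-\<infinity>\<close> and so weight \<open>0\<close>; this needs its own case because
  \<^term>\<open>ln (0::real)\<close> is \<open>0\<close>.
\<close>

definition gumbel_weight :: "real \<Rightarrow> real \<Rightarrow> real \<Rightarrow> real" where
  "gumbel_weight \<tau> p g = (if p = 0 then 0 else exp ((ln p + g) / \<tau>))"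

definition gumbel_softmax :: "real \<Rightarrow> nat \<Rightarrow> (nat \<Rightarrow> real) \<Rightarrow> (nat \<Rightarrow> real) \<Rightarrow> nat \<Rightarrow> real" where
  "gumbel_softmax \<tau> Q p g j =
     gumbel_weight \<tau> (p j) (g j) / (\<Sum>i = 1..Q. gumbel_weight \<tau> (p i) (g i))"

definition dbcd_coord ::
  "real \<Rightarrow> real \<Rightarrow> nat \<Rightarrow> (nat \<Rightarrow> nat \<Rightarrow> real) \<Rightarrow> (nat \<Rightarrow> real) \<Rightarrow> real \<Rightarrow> (nat \<Rightarrow> real) \<Rightarrow> real" where
  "dbcd_coord \<beta> \<tau> Q P vb v g =
     (\<Sum>j = 1..Q. vb j * gumbel_softmax \<tau> Q (detect_prob Q P (soft_assign \<beta> Q vb v)) g j)"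

text \<open>
  The randomness is an explicit argument: \<open>u (i, j)\<close> is the uniform sample for point \<open>j\<close> in
  coordinate \<open>i\<close>.
\<close>

definition dbcd ::
  "real \<Rightarrow> real \<Rightarrow> nat \<Rightarrow> (nat \<Rightarrow> nat \<Rightarrow> real) \<Rightarrow> real ^ 'm \<Rightarrow> (nat \<Rightarrow> real ^ 'm)
     \<Rightarrow> ('m \<times> nat \<Rightarrow> real) \<Rightarrow> real ^ 'm::finite" where
  "dbcd \<beta> \<tau> Q P v V u =
     (\<chi> i. dbcd_coord \<beta> \<tau> Q P (\<lambda>q. V q $ i) (v $ i) (\<lambda>j. gumbel (u (i, j))))"


section \<open>Independent random variables\<close>

text \<open>
  The constant \<^const>\<open>prob_space.indep_var\<close> needs both random variables to have the same type;
  this is the same notion for variables of different types.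
\<close>

definition indep_rv ::
  "'s measure \<Rightarrow> 'a measure \<Rightarrow> ('s \<Rightarrow> 'a) \<Rightarrow> 'b measure \<Rightarrow> ('s \<Rightarrow> 'b) \<Rightarrow> bool" where
  "indep_rv S MX X MY Y \<longleftrightarrow>
     X \<in> measurable S MX \<and> Y \<in> measurable S MY \<and>
     prob_space.indep_set S
       {X -` A \<inter> space S | A. A \<in> sets MX} {Y -` A \<inter> space S | A. A \<in> sets MY}"


section \<open>Isotropic Gaussian distributions\<close>

definition gaussian :: "real ^ 'n \<Rightarrow> real \<Rightarrow> (real ^ 'n::finite) measure" where
  "gaussian \<mu> \<sigma> = density lborel (\<lambda>x. ennreal
     (exp (- (norm (x - \<mu>))\<^sup>2 / (2 * \<sigma>\<^sup>2)) / sqrt (2 * pi * \<sigma>\<^sup>2) ^ CARD('n)))"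


section \<open>Maximum mean discrepancy\<close>

definition mmd2 :: "('a \<Rightarrow> 'a \<Rightarrow> real) \<Rightarrow> 'a measure \<Rightarrow> 'a measure \<Rightarrow> real" where
  "mmd2 K P Q =
     (\<integral>p. K (fst p) (snd p) \<partial>(P \<Otimes>\<^sub>M P)) + (\<integral>p. K (fst p) (snd p) \<partial>(Q \<Otimes>\<^sub>M Q))
       - 2 * (\<integral>p. K (fst p) (snd p) \<partial>(P \<Otimes>\<^sub>M Q))"

definition imq_kernel :: "real \<Rightarrow> 'a::euclidean_space \<Rightarrow> 'a \<Rightarrow> real" where
  "imq_kernel C x y = C / (C + (norm (x - y))\<^sup>2)"

definition pair_kernel ::
  "real \<Rightarrow> 'a::euclidean_space \<times> 'b::euclidean_space \<Rightarrow> 'a \<times> 'b \<Rightarrow> real" where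
  "pair_kernel C p p' = imq_kernel C (fst p) (fst p') * imq_kernel C (snd p) (snd p')"

end

theory Submission
  imports Defs
begin

text \<open>
  The inverse multiquadric kernel has the feature representation
  \<open>k(x, y) = \<integral> \<Phi>(x, \<theta>) \<Phi>(y, \<theta>) dL(\<theta>)\<close> with Gaussian features
  \<open>\<Phi>(x, (t, w)) = exp (- 2 t\<^sup>2 \<parallel>x - w\<parallel>\<^sup>2)\<close>, and products of kernels have product features.  Hence
  the squared MMD is the squared \<open>L\<^sup>2(L)\<close>-distance of the feature means, so a vanishing loss makes the
  feature means agree almost everywhere.  Letting the scale \<open>t\<close> tend to infinity, they determine the
  measure, first in one and then in the other component.  So the law of \<open>f(H)\<close> is the product law
  of \<open>(zhat, r)\<close>, and pushing both forward along the continuous inverse of \<open>f\<close> gives \<open>p\<^sub>H\<close>.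
\<close>

section \<open>Gaussian features of the inverse multiquadric kernel\<close>

lemma nn_integral_lborel_affine:
  fixes f :: "'a::euclidean_space \<Rightarrow> ennreal"
  assumes [measurable]: "f \<in> borel_measurable borel" and "0 < c"
  shows "(\<integral>\<^sup>+x. f x \<partial>lborel) = ennreal (c ^ DIM('a)) * (\<integral>\<^sup>+x. f (t + c *\<^sub>R x) \<partial>lborel)"
  using \<open>0 < c\<close>
  by (subst lborel_affine[of c t])
     (simp_all add: nn_integral_density nn_integral_distr nn_integral_cmult ennreal_power)

lemma nn_integral_exp_neg_square:
  "(\<integral>\<^sup>+x. ennreal (exp (- x\<^sup>2)) \<partial>lborel) = ennreal (sqrt pi)"
proof -
  \<comment> \<open>The variance 1/2 turns the exponent of the normal density into minus the square
    of \<open>x\<close>, with normalizing factor 1 / sqrt pi.\<close>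
  have "exp (- x\<^sup>2) = sqrt pi * normal_density 0 (sqrt (1/2)) x" for x :: real
    by (simp add: normal_density_def)
  then have "(\<integral>\<^sup>+x. ennreal (exp (- x\<^sup>2)) \<partial>lborel) =
      (\<integral>\<^sup>+x. ennreal (sqrt pi) * ennreal (normal_density 0 (sqrt (1/2)) x) \<partial>lborel)"
    by (simp add: ennreal_mult)
  also have "\<dots> = ennreal (sqrt pi) * (\<integral>\<^sup>+x. ennreal (normal_density 0 (sqrt (1/2)) x) \<partial>lborel)"
    by (rule nn_integral_cmult) simp
  also have "(\<integral>\<^sup>+x. ennreal (normal_density 0 (sqrt (1/2)) x) \<partial>lborel) = 1"
    by (subst nn_integral_eq_integral) (simp_all)
  finally show ?thesis by simp
qed

text \<open>The centred Gaussian of unit scale factors over the coordinates into one-dimensional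
  integrals. Centre \<open>x\<close> and scale \<open>c\<close> are then reached by an affine
  substitution with Jacobian \<open>(1 / c) ^ DIM('a)\<close>.\<close>

lemma nn_integral_gaussian_euclidean:
  fixes x :: "'a::euclidean_space"
  assumes "0 < c"
  shows "(\<integral>\<^sup>+w. ennreal (exp (- (c * norm (x - w))\<^sup>2)) \<partial>lborel) = ennreal ((sqrt pi / c) ^ DIM('a))"
proof -
  have unit: "(\<integral>\<^sup>+w. ennreal (exp (- (norm (w::'a))\<^sup>2)) \<partial>lborel) = ennreal (sqrt pi ^ DIM('a))"
  proof -
    have "exp (- (norm w)\<^sup>2) = (\<Prod>b\<in>Basis. exp (- (w \<bullet> b)\<^sup>2))" for w :: 'a
      unfolding norm_conv_dist euclidean_dist_l2[of w 0]
      by (simp add: L2_set_def sum_nonneg exp_sum[symmetric] sum_negf dist_real_def)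
    then have "(\<integral>\<^sup>+w. ennreal (exp (- (norm (w::'a))\<^sup>2)) \<partial>lborel) =
        (\<integral>\<^sup>+w. (\<Prod>b\<in>Basis. ennreal (exp (- ((w::'a) \<bullet> b)\<^sup>2))) \<partial>lborel)"
      by (simp add: prod_ennreal)
    also have "\<dots> = (\<Prod>b\<in>(Basis::'a set). (\<integral>\<^sup>+x. ennreal (exp (- x\<^sup>2)) \<partial>lborel))"
      by (rule nn_integral_lborel_prod) simp_all
    finally show ?thesis
      by (simp add: nn_integral_exp_neg_square ennreal_power)
  qed
  have "(\<integral>\<^sup>+w. ennreal (exp (- (c * norm (x - w))\<^sup>2)) \<partial>lborel) =
      ennreal ((1 / c) ^ DIM('a)) * (\<integral>\<^sup>+w. ennreal (exp (- (norm (w::'a))\<^sup>2)) \<partial>lborel)"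
    using assms by (subst nn_integral_lborel_affine[where c="1 / c" and t=x]) simp_all
  with assms show ?thesis
    by (simp add: unit ennreal_mult[symmetric] power_mult_distrib[symmetric])
qed

section \<open>Features, scale density and the measure on feature parameters\<close>

definition gauss_feature :: "'a::euclidean_space \<Rightarrow> real \<times> 'a \<Rightarrow> real" where
  "gauss_feature x \<theta> = exp (- 2 * (fst \<theta> * norm (x - snd \<theta>))\<^sup>2)"

text \<open>The power of \<open>2 * t / sqrt pi\<close> normalizes the Gaussian in the location that
  arises from a product of two features at scale \<open>t\<close>. The remaining factor
  \<open>2 * t * C * exp (- C * t\<^sup>2)\<close> is chosen so that integration over
  \<open>t\<close> yields the inverse multiquadric. The type argument only carries the
  dimension.\<close>

definition imq_scale_density :: "real \<Rightarrow> 'a::euclidean_space itself \<Rightarrow> real \<Rightarrow> real" where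
  "imq_scale_density C _ t =
     (if 0 < t then 2 * t * C * exp (- C * t\<^sup>2) * (2 * t / sqrt pi) ^ DIM('a) else 0)"

definition imq_feature_measure :: "real \<Rightarrow> (real \<times> 'a::euclidean_space) measure" where
  "imq_feature_measure C =
     density (lborel \<Otimes>\<^sub>M lborel) (\<lambda>\<theta>. ennreal (imq_scale_density C TYPE('a) (fst \<theta>)))"

lemma gauss_feature_measurable[measurable]:
  "(\<lambda>p. gauss_feature (fst p) (snd p)) \<in> borel_measurable (borel \<Otimes>\<^sub>M (borel \<Otimes>\<^sub>M borel))"
  unfolding gauss_feature_def by measurable

lemma gauss_feature_measurable_compose[measurable (raw)]:
  assumes "f \<in> borel_measurable M" "g \<in> M \<rightarrow>\<^sub>M (borel \<Otimes>\<^sub>M borel)"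
  shows "(\<lambda>x. gauss_feature (f x) (g x)) \<in> borel_measurable M"
  using measurable_compose[OF measurable_Pair[OF assms] gauss_feature_measurable] by simp

lemma gauss_feature_section_measurable[measurable]:
  "(\<lambda>x. gauss_feature x \<theta>) \<in> borel_measurable borel"
  unfolding gauss_feature_def by measurable

lemma gauss_feature_nonneg[simp]: "0 \<le> gauss_feature x \<theta>"
  by (simp add: gauss_feature_def)

lemma gauss_feature_le_1[simp]: "gauss_feature x \<theta> \<le> 1"
  by (simp add: gauss_feature_def)

lemma imq_scale_density_measurable[measurable]: "imq_scale_density C I \<in> borel_measurable borel"
  unfolding imq_scale_density_def by measurable

lemma sets_imq_feature_measure[measurable_cong]:
  "sets (imq_feature_measure C) = sets (borel \<Otimes>\<^sub>M borel)"
  unfolding imq_feature_measure_def sets_density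
  by (rule sets_pair_measure_cong) simp_all

lemma sigma_finite_imq_feature_measure:
  "sigma_finite_measure (imq_feature_measure C :: (real \<times> 'a::euclidean_space) measure)"
proof -
  interpret pair_sigma_finite "lborel :: real measure" "lborel :: 'a measure" ..
  show ?thesis
    unfolding imq_feature_measure_def by (subst sigma_finite_measure.sigma_finite_iff_density_finite) (unfold_locales, simp_all)
qed

text \<open>The density is strictly positive for every positive scale, so on that half space the
  null sets of the feature measure are Lebesgue null sets.\<close>

lemma AE_imq_feature_measure:
  assumes "0 < C" "AE \<theta> in imq_feature_measure C. R \<theta>"
  shows "AE \<theta> in lborel \<Otimes>\<^sub>M (lborel :: 'a::euclidean_space measure). 0 < fst \<theta> \<longrightarrow> R \<theta>"
proof -
  have "AE \<theta> in lborel \<Otimes>\<^sub>M (lborel :: 'a measure).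
      0 < ennreal (imq_scale_density C TYPE('a) (fst \<theta>)) \<longrightarrow> R \<theta>"
    using assms(2) unfolding imq_feature_measure_def by (subst (asm) AE_density) simp_all
  then show ?thesis
    by eventually_elim (use \<open>0 < C\<close> in \<open>auto simp: imq_scale_density_def\<close>)
qed

text \<open>The integrand is the derivative of \<open>- (C / E) * exp (- E * t\<^sup>2)\<close>,
  which rises from \<open>- (C / E)\<close> at 0 to the limit 0 at infinity.\<close>

lemma nn_integral_imq_scale:
  assumes "0 < E" "0 \<le> C"
  shows "(\<integral>\<^sup>+t. ennreal (2 * t * C * exp (- E * t\<^sup>2)) * indicator {0..} t \<partial>lborel) = ennreal (C / E)"
proof -
  have lim: "((\<lambda>t. - (C / E) * exp (- E * t\<^sup>2)) \<longlongrightarrow> - (C / E) * 0) at_top"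
  proof (intro tendsto_intros filterlim_compose[OF exp_at_bot])
    show "LIM t at_top. - E * t\<^sup>2 :> at_bot"
      using \<open>0 < E\<close> by (intro filterlim_tendsto_neg_mult_at_bot[OF tendsto_const] filterlim_pow_at_top
          filterlim_ident) simp_all
  qed
  have "(\<integral>\<^sup>+t. ennreal (2 * t * C * exp (- E * t\<^sup>2)) * indicator {0..} t \<partial>lborel) =
     ennreal (- (C / E) * 0 - (- (C / E) * exp (- E * 0\<^sup>2)))"
  proof (rule nn_integral_FTC_atLeast[OF _ _ _ lim])
    show "(\<lambda>t. 2 * t * C * exp (- E * t\<^sup>2)) \<in> borel_measurable borel" by measurable
    show "DERIV (\<lambda>t. - (C / E) * exp (- E * t\<^sup>2)) t :> 2 * t * C * exp (- E * t\<^sup>2)"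
      for t
      using \<open>0 < E\<close> by (auto intro!: derivative_eq_intros)
    show "0 \<le> 2 * t * C * exp (- E * t\<^sup>2)" if "0 \<le> t" for t
      using that assms by simp
  qed
  then show ?thesis by simp
qed

text \<open>The parallelogram identity turns the product of two Gaussian features into the Gaussian of
  \<open>x - y\<close> times a Gaussian centred at the midpoint; integrating over the scale then gives
  \<open>\<integral> 2 t C exp (- (C + \<parallel>x - y\<parallel>\<^sup>2) t\<^sup>2) dt\<close>.\<close>

lemma nn_integral_imq_feature:
  fixes x y :: "'a::euclidean_space"
  assumes "0 < C"
  shows "(\<integral>\<^sup>+\<theta>. ennreal (gauss_feature x \<theta> * gauss_feature y \<theta>) \<partial>imq_feature_measure C) =
    ennreal (imq_kernel C x y)"
proof -
  let ?d = "imq_scale_density C TYPE('a)"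
  define D where "D = (norm (x - y))\<^sup>2"
  define m where "m = (1 / 2) *\<^sub>R (x + y)"
  have mid: "2 * (norm (x - w))\<^sup>2 + 2 * (norm (y - w))\<^sup>2 = D + 4 * (norm (m - w))\<^sup>2" for w
    unfolding power2_norm_eq_inner m_def D_def by (simp add: algebra_simps inner_commute)
  \<comment> \<open>The factor 2 in the exponent of \<open>gauss_feature\<close> is what gives
    \<open>D\<close> the coefficient 1 here, so that the kernel appears with \<open>C + D\<close>
    and no extra constant.\<close>
  have prod: "gauss_feature x (t, w) * gauss_feature y (t, w) =
      exp (- D * t\<^sup>2) * exp (- (2 * t * norm (m - w))\<^sup>2)" for t w
  proof -
    have "- 2 * (t * norm (x - w))\<^sup>2 + - 2 * (t * norm (y - w))\<^sup>2 =
        - (t\<^sup>2 * (2 * (norm (x - w))\<^sup>2 + 2 * (norm (y - w))\<^sup>2))"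
      by (simp add: power_mult_distrib algebra_simps)
    also have "\<dots> = - D * t\<^sup>2 + - (2 * t * norm (m - w))\<^sup>2"
      unfolding mid by (simp add: power_mult_distrib algebra_simps)
    finally show ?thesis
      by (simp add: gauss_feature_def mult_exp_exp)
  qed
  have "(\<integral>\<^sup>+\<theta>. ennreal (gauss_feature x \<theta> * gauss_feature y \<theta>) \<partial>imq_feature_measure C) =
      (\<integral>\<^sup>+\<theta>. ennreal (?d (fst \<theta>)) * ennreal (gauss_feature x \<theta> * gauss_feature y \<theta>) \<partial>(lborel \<Otimes>\<^sub>M lborel))"
    unfolding imq_feature_measure_def by (subst nn_integral_density) simp_all
  also have "\<dots> = (\<integral>\<^sup>+t. \<integral>\<^sup>+w. ennreal (?d t) * ennreal (gauss_feature x (t, w) * gauss_feature y (t, w)) \<partial>lborel \<partial>lborel)"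
    by (subst lborel.nn_integral_fst[symmetric]) simp_all
  also have "\<dots> = (\<integral>\<^sup>+t. ennreal (2 * t * C * exp (- (C + D) * t\<^sup>2)) * indicator {0..} t \<partial>lborel)"
  proof (rule nn_integral_cong)
    fix t :: real
    show "(\<integral>\<^sup>+w. ennreal (?d t) * ennreal (gauss_feature x (t, w) * gauss_feature y (t, w)) \<partial>lborel) =
        ennreal (2 * t * C * exp (- (C + D) * t\<^sup>2)) * indicator {0..} t"
    proof (cases "0 < t")
      case True
      have "(\<integral>\<^sup>+w. ennreal (?d t) * ennreal (gauss_feature x (t, w) * gauss_feature y (t, w)) \<partial>lborel) =
        (\<integral>\<^sup>+w. ennreal (?d t * exp (- D * t\<^sup>2)) * ennreal (exp (- (2 * t * norm (m - w))\<^sup>2)) \<partial>lborel)"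
        using True assms unfolding prod
        by (intro nn_integral_cong) (simp add: ennreal_mult[symmetric] imq_scale_density_def mult.assoc)
      also have "\<dots> = ennreal (?d t * exp (- D * t\<^sup>2)) * ennreal ((sqrt pi / (2 * t)) ^ DIM('a))"
        using True by (simp add: nn_integral_cmult nn_integral_gaussian_euclidean)
      also have "\<dots> = ennreal (?d t * exp (- D * t\<^sup>2) * (sqrt pi / (2 * t)) ^ DIM('a))"
        using True assms by (simp add: ennreal_mult imq_scale_density_def)
      \<comment> \<open>Regrouping makes the normalizing power in the scale density meet the
        location integral; the two cancel.\<close>
      also have "?d t * exp (- D * t\<^sup>2) * (sqrt pi / (2 * t)) ^ DIM('a) =
          2 * t * C * (exp (- C * t\<^sup>2) * exp (- D * t\<^sup>2)) *
          ((2 * t / sqrt pi) * (sqrt pi / (2 * t))) ^ DIM('a)"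
        unfolding power_mult_distrib using True by (simp add: imq_scale_density_def)
      also have "(2 * t / sqrt pi) * (sqrt pi / (2 * t)) = 1"
        using True by simp
      also have "exp (- C * t\<^sup>2) * exp (- D * t\<^sup>2) = exp (- (C + D) * t\<^sup>2)"
        by (simp add: mult_exp_exp algebra_simps)
      finally show ?thesis using True by simp
    next
      case False
      \<comment> \<open>The half line on the right is closed: at \<open>t = 0\<close> the indicator
        is 1, and it is the factor \<open>t\<close> that makes both sides vanish.\<close>
      then show ?thesis by (cases "t = 0") (simp_all add: imq_scale_density_def indicator_def)
    qed
  qed
  also have "\<dots> = ennreal (C / (C + D))"
    using assms by (intro nn_integral_imq_scale add_pos_nonneg) (simp_all add: D_def)
  finally show ?thesis by (simp add: imq_kernel_def D_def)
qed

section \<open>Kernel mean embeddings\<close>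

lemma integrable_unit_bounded:
  fixes f :: "'a \<Rightarrow> real"
  assumes "finite_measure P" "f \<in> borel_measurable P" "\<And>x. 0 \<le> f x" "\<And>x. f x \<le> 1"
  shows "integrable P f"
  using assms by (intro finite_measure.integrable_const_bound[of P f 1]) auto

text \<open>Turns joint measurability of a two-argument function into a composition rule that the
  measurability prover can apply to the abstract features.\<close>

lemma measurable_compose_Pair:
  assumes "(\<lambda>p. f (fst p) (snd p)) \<in> (M \<Otimes>\<^sub>M L) \<rightarrow>\<^sub>M K" "u \<in> N \<rightarrow>\<^sub>M M" "v \<in> N \<rightarrow>\<^sub>M L"
  shows "(\<lambda>x. f (u x) (v x)) \<in> N \<rightarrow>\<^sub>M K"
  using measurable_compose[OF measurable_Pair[OF assms(2,3)] assms(1)] by simp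

text \<open>Tonelli turns each kernel expectation into an inner product of feature means in L2 of
  \<open>L\<close>. The three terms of the MMD are then the expansion of a square, and a nonnegative
  function with integral 0 vanishes almost everywhere.\<close>

lemma mmd2_eq_0_imp_features_eq:
  fixes \<Phi> :: "'a \<Rightarrow> 't \<Rightarrow> real"
  assumes P: "prob_space P" and Q: "prob_space Q" and L: "sigma_finite_measure L"
    and sets[measurable_cong]: "sets P = sets M" "sets Q = sets M"
    and \<Phi>: "(\<lambda>p. \<Phi> (fst p) (snd p)) \<in> borel_measurable (M \<Otimes>\<^sub>M L)"
    and \<Phi>_bounds: "\<And>x \<theta>. 0 \<le> \<Phi> x \<theta>" "\<And>x \<theta>. \<Phi> x \<theta> \<le> 1"
    and K[measurable]: "(\<lambda>p. K (fst p) (snd p)) \<in> borel_measurable (M \<Otimes>\<^sub>M M)"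
    and K_bounds: "\<And>x y. 0 \<le> K x y" "\<And>x y. K x y \<le> 1"
    and rep: "\<And>x y. (\<integral>\<^sup>+\<theta>. ennreal (\<Phi> x \<theta> * \<Phi> y \<theta>) \<partial>L) = ennreal (K x y)"
    and zero: "mmd2 K P Q = 0"
  shows "AE \<theta> in L. (\<integral>\<^sup>+x. ennreal (\<Phi> x \<theta>) \<partial>P) = (\<integral>\<^sup>+x. ennreal (\<Phi> x \<theta>) \<partial>Q)"
proof -
  interpret L: sigma_finite_measure L by fact
  note [measurable (raw)] = measurable_compose_Pair[OF \<Phi>]
  define m where "m R \<theta> = (\<integral>x. \<Phi> x \<theta> \<partial>R)" for R \<theta>
  \<comment> \<open>Features are bounded by 1 on a probability space, so their means are finite and
    the two notions of integral agree.\<close>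
  have m_nn: "(\<integral>\<^sup>+x. ennreal (\<Phi> x \<theta>) \<partial>R) = ennreal (m R \<theta>)"
    if "prob_space R" and [measurable_cong]: "sets R = sets M" and [measurable]: "\<theta> \<in> space L" for R \<theta>
    unfolding m_def using that(1) \<Phi>_bounds
    by (intro nn_integral_eq_integral integrable_unit_bounded)
       (auto dest: prob_space.finite_measure)
  have m_nonneg: "0 \<le> m R \<theta>" for R \<theta>
    unfolding m_def using \<Phi>_bounds by simp
  have m_measurable: "m R \<in> borel_measurable L"
    if "prob_space R" and [measurable_cong]: "sets R = sets M" for R
  proof -
    interpret R: prob_space R by fact
    show ?thesis unfolding m_def by measurable
  qed
  \<comment> \<open>Stated for an arbitrary pair of measures, because it is instantiated three
    times: for both diagonal terms and for the mixed term.\<close>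
  have cross: "integrable L (\<lambda>\<theta>. m R \<theta> * m R' \<theta>)"
      "(\<integral>\<theta>. m R \<theta> * m R' \<theta> \<partial>L) = (\<integral>p. K (fst p) (snd p) \<partial>(R \<Otimes>\<^sub>M R'))"
    if R: "prob_space R" "sets R = sets M" and R': "prob_space R'" "sets R' = sets M" for R R'
  proof -
    interpret R: prob_space R by fact
    interpret R': prob_space R' by fact
    interpret RR': pair_prob_space R R' ..
    interpret RL: pair_sigma_finite R L ..
    interpret R'L: pair_sigma_finite R' L ..
    note [measurable_cong] = R(2) R'(2)
    have int: "integrable (R \<Otimes>\<^sub>M R') (\<lambda>p. K (fst p) (snd p))"
      using K_bounds by (intro integrable_unit_bounded) (auto intro: RR'.finite_measure_axioms)
    have "ennreal (\<integral>p. K (fst p) (snd p) \<partial>(R \<Otimes>\<^sub>M R')) = (\<integral>\<^sup>+p. ennreal (K (fst p) (snd p)) \<partial>(R \<Otimes>\<^sub>M R'))"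
      using K_bounds by (intro nn_integral_eq_integral[symmetric] int) simp
    also have "\<dots> = (\<integral>\<^sup>+x. \<integral>\<^sup>+y. ennreal (K x y) \<partial>R' \<partial>R)"
      by (subst R'.nn_integral_fst[symmetric]) simp_all
    \<comment> \<open>The kernel is replaced by its feature representation; two exchanges of
      integrals then bring the feature parameter outside.\<close>
    also have "\<dots> = (\<integral>\<^sup>+x. \<integral>\<^sup>+y. \<integral>\<^sup>+\<theta>. ennreal (\<Phi> x \<theta> * \<Phi> y \<theta>) \<partial>L \<partial>R' \<partial>R)"
      by (simp add: rep)
    also have "\<dots> = (\<integral>\<^sup>+x. \<integral>\<^sup>+\<theta>. \<integral>\<^sup>+y. ennreal (\<Phi> x \<theta> * \<Phi> y \<theta>) \<partial>R' \<partial>L \<partial>R)"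
    proof (rule nn_integral_cong)
      fix x assume "x \<in> space R"
      then have [measurable]: "x \<in> space M" by (simp add: sets_eq_imp_space_eq[OF R(2)])
      show "(\<integral>\<^sup>+y. \<integral>\<^sup>+\<theta>. ennreal (\<Phi> x \<theta> * \<Phi> y \<theta>) \<partial>L \<partial>R') =
          (\<integral>\<^sup>+\<theta>. \<integral>\<^sup>+y. ennreal (\<Phi> x \<theta> * \<Phi> y \<theta>) \<partial>R' \<partial>L)"
        by (intro R'L.Fubini'[symmetric]) measurable
    qed
    also have "\<dots> = (\<integral>\<^sup>+\<theta>. \<integral>\<^sup>+x. \<integral>\<^sup>+y. ennreal (\<Phi> x \<theta> * \<Phi> y \<theta>) \<partial>R' \<partial>R \<partial>L)"
      by (intro RL.Fubini'[symmetric]) measurable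
    also have "\<dots> = (\<integral>\<^sup>+\<theta>. ennreal (m R \<theta> * m R' \<theta>) \<partial>L)"
    proof (rule nn_integral_cong)
      fix \<theta> assume \<theta>[measurable]: "\<theta> \<in> space L"
      show "(\<integral>\<^sup>+x. \<integral>\<^sup>+y. ennreal (\<Phi> x \<theta> * \<Phi> y \<theta>) \<partial>R' \<partial>R) = ennreal (m R \<theta> * m R' \<theta>)"
        using \<Phi>_bounds
        by (simp add: ennreal_mult nn_integral_cmult nn_integral_multc m_nn[OF R \<theta>] m_nn[OF R' \<theta>] m_nonneg)
    qed
    finally have eq: "(\<integral>\<^sup>+\<theta>. ennreal (m R \<theta> * m R' \<theta>) \<partial>L) =
        ennreal (\<integral>p. K (fst p) (snd p) \<partial>(R \<Otimes>\<^sub>M R'))" ..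
    have [measurable]: "m R \<in> borel_measurable L" "m R' \<in> borel_measurable L"
      using R R' by (simp_all add: m_measurable)
    \<comment> \<open>Although \<open>L\<close> may have infinite mass, the product of means is
      integrable: its nonnegative integral was just identified with a finite kernel
      expectation.\<close>
    show "integrable L (\<lambda>\<theta>. m R \<theta> * m R' \<theta>)"
      using eq by (intro integrableI_nonneg) (simp_all add: m_nonneg)
    show "(\<integral>\<theta>. m R \<theta> * m R' \<theta> \<partial>L) = (\<integral>p. K (fst p) (snd p) \<partial>(R \<Otimes>\<^sub>M R'))"
      using K_bounds by (subst integral_eq_nn_integral) (simp_all add: eq m_nonneg)
  qed
  note PP = cross[OF P sets(1) P sets(1)] and QQ = cross[OF Q sets(2) Q sets(2)]
    and PQ = cross[OF P sets(1) Q sets(2)]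
  have square: "(m P \<theta> - m Q \<theta>)\<^sup>2 = m P \<theta> * m P \<theta> + m Q \<theta> * m Q \<theta> - 2 * (m P \<theta> * m Q \<theta>)" for \<theta>
    by (simp add: power2_eq_square algebra_simps)
  have "integrable L (\<lambda>\<theta>. (m P \<theta> - m Q \<theta>)\<^sup>2)"
    unfolding square using PP(1) QQ(1) PQ(1) by simp
  moreover have "(\<integral>\<theta>. (m P \<theta> - m Q \<theta>)\<^sup>2 \<partial>L) = mmd2 K P Q"
    unfolding square mmd2_def using PP QQ PQ by simp
  ultimately have "AE \<theta> in L. (m P \<theta> - m Q \<theta>)\<^sup>2 = 0"
    using zero integral_nonneg_eq_0_iff_AE[of L "\<lambda>\<theta>. (m P \<theta> - m Q \<theta>)\<^sup>2"] by simp
  then show ?thesis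
    using AE_space by eventually_elim (simp add: m_nn P Q sets)
qed

section \<open>Finite measures are determined by their Gaussian feature means\<close>

lemma finite_borel_measure_eqI_continuous:
  fixes P Q :: "'a::metric_space measure"
  assumes P: "finite_measure P" "sets P = sets borel" and Q: "finite_measure Q" "sets Q = sets borel"
    and eq: "\<And>h :: 'a \<Rightarrow> real. continuous_on UNIV h \<Longrightarrow> (\<And>x. 0 \<le> h x) \<Longrightarrow> (\<And>x. h x \<le> 1) \<Longrightarrow>
      (\<integral>\<^sup>+x. ennreal (h x) \<partial>P) = (\<integral>\<^sup>+x. ennreal (h x) \<partial>Q)"
  shows "P = Q"
proof (rule measure_eqI_generator_eq)
  note [measurable_cong] = P(2) Q(2)
  let ?E = "{U :: 'a set. open U}"
  show "Int_stable ?E" by (auto simp: Int_stable_def)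
  show "?E \<subseteq> Pow UNIV" by simp
  show "sets P = sigma_sets UNIV ?E" "sets Q = sigma_sets UNIV ?E"
    using P Q by (simp_all add: borel_def)
  show "range (\<lambda>_::nat. UNIV :: 'a set) \<subseteq> ?E" "(\<Union>i::nat. UNIV :: 'a set) = UNIV" by auto
  show "emeasure P UNIV \<noteq> \<infinity>" for i :: nat
    using finite_measure.emeasure_finite[OF P(1)] by simp
  show "emeasure P U = emeasure Q U" if "U \<in> ?E" for U
  proof -
    \<comment> \<open>Continuous functions that converge pointwise to the indicator of the open set
      \<open>U\<close>. The whole space is treated apart because \<open>infdist\<close> to the empty
      set is 0 by convention.\<close>
    define h where "h n x = (if U = UNIV then 1 else min 1 (real n * infdist x (- U)))" for n x
    have h: "continuous_on UNIV (h n)" "0 \<le> h n x" "h n x \<le> 1" for n x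
      unfolding h_def by (cases "U = UNIV"; auto intro!: continuous_intros simp: infdist_nonneg)+
    have [measurable]: "h n \<in> borel_measurable borel" for n
      using h by (intro borel_measurable_continuous_onI)
    have [measurable]: "U \<in> sets borel" using that by simp
    have lim: "(\<lambda>n. ennreal (h n x)) \<longlonglongrightarrow> indicator U x" for x
    proof (cases "x \<in> U")
      case True
      have "eventually (\<lambda>n. h n x = 1) sequentially"
      proof (cases "U = UNIV")
        case False
        with True that have "0 < infdist x (- U)"
          by (intro infdist_pos_not_in_closed) auto
        then have "filterlim (\<lambda>n. real n * infdist x (- U)) at_top sequentially"
          by (intro filterlim_at_top_mult_tendsto_pos[OF tendsto_const] filterlim_real_sequentially)
        then have "eventually (\<lambda>n. 1 \<le> real n * infdist x (- U)) sequentially"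
          by (simp add: filterlim_at_top)
        then show ?thesis by eventually_elim (simp add: h_def)
      qed (simp add: h_def)
      with True show ?thesis
        by (intro tendsto_eventually) (auto elim: eventually_mono)
    next
      case False
      then have "U \<noteq> UNIV" "infdist x (- U) = 0" by auto
      with False show ?thesis by (simp add: h_def)
    qed
    have conv: "(\<lambda>n. \<integral>\<^sup>+x. ennreal (h n x) \<partial>R) \<longlonglongrightarrow> emeasure R U"
      if "finite_measure R" and [measurable_cong]: "sets R = sets borel" for R
    proof -
      have "(\<lambda>n. \<integral>\<^sup>+x. ennreal (h n x) \<partial>R) \<longlonglongrightarrow> (\<integral>\<^sup>+x. indicator U x \<partial>R)"
        using h(3) lim finite_measure.emeasure_finite[OF that(1), of "space R"]
        by (intro nn_integral_dominated_convergence[where w="\<lambda>_. 1"])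
           (auto simp: less_top)
      then show ?thesis by (simp add: that(2))
    qed
    from conv[OF P] conv[OF Q] show ?thesis
      unfolding eq[OF h] by (rule LIMSEQ_unique)
  qed
qed

text \<open>The feature means determine the convolutions of the measure with Gaussians of width
  \<open>1 / t\<close>, and these converge weakly to the measure for \<open>t \<longrightarrow> \<infinity>\<close>.\<close>

lemma finite_measure_eqI_gauss_feature:
  fixes P Q :: "'a::euclidean_space measure"
  assumes P: "finite_measure P" "sets P = sets borel" and Q: "finite_measure Q" "sets Q = sets borel"
    and eq: "AE \<theta> in lborel \<Otimes>\<^sub>M lborel. 0 < fst \<theta> \<longrightarrow>
      (\<integral>\<^sup>+x. ennreal (gauss_feature x \<theta>) \<partial>P) = (\<integral>\<^sup>+x. ennreal (gauss_feature x \<theta>) \<partial>Q)"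
  shows "P = Q"
proof (rule finite_borel_measure_eqI_continuous[OF P Q])
  fix h :: "'a \<Rightarrow> real"
  assume h: "continuous_on UNIV h" "\<And>x. 0 \<le> h x" "\<And>x. h x \<le> 1"
  have [measurable]: "h \<in> borel_measurable borel"
    using h(1) by (rule borel_measurable_continuous_onI)
  define G where "G t w R = (\<integral>\<^sup>+x. ennreal (gauss_feature x (t, w)) \<partial>R)" for t w and R :: "'a measure"
  have AE_t: "AE t in lborel. 0 < t \<longrightarrow> (AE w in lborel. G t w P = G t w Q)"
    using lborel_pair.AE_pair[OF eq] unfolding G_def by eventually_elim simp
  \<comment> \<open>The bad positive scales form a null set, which cannot contain an interval of
    length 1. Hence there are good scales beyond every bound.\<close>
  have "\<exists>t>real n. AE w in lborel. G t w P = G t w Q" for n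
  proof (rule ccontr)
    assume *: "\<not> ?thesis"
    from AE_t have "AE t in lborel. t \<notin> {real n<..<real n + 1}"
      by eventually_elim (use * in auto)
    then have "emeasure lborel {real n<..<real n + 1} = 0"
      by (subst (asm) AE_iff_measurable[of "{real n<..<real n + 1}"]) auto
    moreover have "emeasure lborel {real n<..<real n + 1} = 1"
      by (subst emeasure_lborel_Ioo) auto
    ultimately show False by simp
  qed
  then obtain t where t: "\<And>n. real n < t n" and AE_w: "\<And>n. AE w in lborel. G (t n) w P = G (t n) w Q"
    by metis
  have t_pos: "0 < t n" for n
    using t[of n] by (meson le_less_trans of_nat_0_le_iff)
  \<comment> \<open>The total mass of the feature profile in the rescaled variable. It is positive
    and finite, so it can be cancelled at the end.\<close>
  define k where "k = (\<integral>\<^sup>+y. ennreal (exp (- 2 * (norm (y::'a))\<^sup>2)) \<partial>lborel)"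
  have k: "k = ennreal ((sqrt pi / sqrt 2) ^ DIM('a))"
    using nn_integral_gaussian_euclidean[of "sqrt 2" "0 :: 'a"]
    by (simp add: k_def power_mult_distrib)
  \<comment> \<open>An unnormalized Gaussian average of \<open>h\<close> around \<open>x\<close> at
    width \<open>1 / t n\<close>. As the width shrinks it tends to \<open>k\<close> times
    \<open>h x\<close>, by dominated convergence and continuity of \<open>h\<close>.\<close>
  define A where "A n x = (\<integral>\<^sup>+y. ennreal (h (x + (1 / t n) *\<^sub>R y)) * ennreal (exp (- 2 * (norm y)\<^sup>2)) \<partial>lborel)"
    for n x
  have [measurable]: "A n \<in> borel_measurable borel" for n
    unfolding A_def by measurable
  have A_le: "A n x \<le> k" for n x
    unfolding A_def k_def using h(3)
    by (intro nn_integral_mono) (metis ennreal_le_1 mult_left_mono mult_1 mult_right_mono zero_le)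
  have A_lim: "(\<lambda>n. A n x) \<longlonglongrightarrow> k * ennreal (h x)" for x
  proof -
    have tlim: "(\<lambda>n. 1 / t n) \<longlonglongrightarrow> 0"
    proof (rule tendsto_divide_0[OF tendsto_const])
      have "filterlim t at_top sequentially"
        by (rule filterlim_at_top_mono[OF filterlim_real_sequentially])
           (use t in \<open>auto intro!: always_eventually less_imp_le\<close>)
      then show "filterlim t at_infinity sequentially"
        by (rule filterlim_at_top_imp_at_infinity)
    qed
    have hlim: "(\<lambda>n. h (x + (1 / t n) *\<^sub>R y)) \<longlonglongrightarrow> h x" for y
    proof -
      have "(\<lambda>n. x + (1 / t n) *\<^sub>R y) \<longlonglongrightarrow> x + 0 *\<^sub>R y"
        by (intro tendsto_intros tlim)
      then show ?thesis
        using h(1) by (intro isCont_tendsto_compose[where g=h]) (auto simp: continuous_on_eq_continuous_at)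
    qed
    have "(\<lambda>n. A n x) \<longlonglongrightarrow> (\<integral>\<^sup>+y. ennreal (h x) * ennreal (exp (- 2 * (norm (y::'a))\<^sup>2)) \<partial>lborel)"
      unfolding A_def
    proof (rule nn_integral_dominated_convergence[where w="\<lambda>y. ennreal (exp (- 2 * (norm y)\<^sup>2))"])
      show "AE y in lborel. ennreal (h (x + (1 / t n) *\<^sub>R y)) * ennreal (exp (- 2 * (norm y)\<^sup>2))
          \<le> ennreal (exp (- 2 * (norm y)\<^sup>2))" for n
        using h(3) by (intro AE_I2) (metis ennreal_le_1 mult_1 mult_right_mono zero_le)
      show "(\<integral>\<^sup>+y. ennreal (exp (- 2 * (norm (y::'a))\<^sup>2)) \<partial>lborel) < \<infinity>"
        unfolding k_def[symmetric] k by simp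
      show "AE y in lborel. (\<lambda>n. ennreal (h (x + (1 / t n) *\<^sub>R y)) * ennreal (exp (- 2 * (norm y)\<^sup>2)))
          \<longlonglongrightarrow> ennreal (h x) * ennreal (exp (- 2 * (norm y)\<^sup>2))"
        using h(2) by (intro AE_I2) (simp add: ennreal_mult[symmetric] tendsto_intros hlim)
    qed measurable
    then show ?thesis
      unfolding k_def by (simp add: nn_integral_cmult mult.commute)
  qed
  \<comment> \<open>The substitution \<open>w = x + (1 / t n) *\<^sub>R y\<close> turns the average
    into an integral of \<open>h\<close> against the feature; Tonelli then moves the average over
    \<open>x\<close> inside and exposes the feature mean.\<close>
  have smooth: "ennreal ((1 / t n) ^ DIM('a)) * (\<integral>\<^sup>+x. A n x \<partial>R) = (\<integral>\<^sup>+w. ennreal (h w) * G (t n) w R \<partial>lborel)"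
    if "finite_measure R" and [measurable_cong]: "sets R = sets borel" for n R
  proof -
    interpret R: finite_measure R by fact
    interpret RL: pair_sigma_finite R "lborel :: 'a measure" ..
    have "ennreal ((1 / t n) ^ DIM('a)) * A n x =
        (\<integral>\<^sup>+w. ennreal (h w) * ennreal (gauss_feature x (t n, w)) \<partial>lborel)" for x
      using t_pos[of n] unfolding A_def
      by (subst nn_integral_lborel_affine[where c="1 / t n" and t=x]) (simp_all add: gauss_feature_def)
    then have "ennreal ((1 / t n) ^ DIM('a)) * (\<integral>\<^sup>+x. A n x \<partial>R) =
        (\<integral>\<^sup>+x. \<integral>\<^sup>+w. ennreal (h w) * ennreal (gauss_feature x (t n, w)) \<partial>lborel \<partial>R)"
      by (simp add: nn_integral_cmult[symmetric])
    also have "\<dots> = (\<integral>\<^sup>+w. \<integral>\<^sup>+x. ennreal (h w) * ennreal (gauss_feature x (t n, w)) \<partial>R \<partial>lborel)"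
      by (intro RL.Fubini'[symmetric]) measurable
    finally show ?thesis
      unfolding G_def by (simp add: nn_integral_cmult)
  qed
  have A_eq: "(\<integral>\<^sup>+x. A n x \<partial>P) = (\<integral>\<^sup>+x. A n x \<partial>Q)" for n
  proof -
    have "(\<integral>\<^sup>+w. ennreal (h w) * G (t n) w P \<partial>lborel) = (\<integral>\<^sup>+w. ennreal (h w) * G (t n) w Q \<partial>lborel)"
      by (rule nn_integral_cong_AE) (use AE_w[of n] in eventually_elim, simp)
    then show ?thesis
      unfolding smooth[OF P, symmetric] smooth[OF Q, symmetric]
      using t_pos[of n] by (simp add: ennreal_mult_cancel_left)
  qed
  \<comment> \<open>The averages are bounded by the constant \<open>k\<close>, which is integrable
    because \<open>R\<close> is finite.\<close>
  have conv: "(\<lambda>n. \<integral>\<^sup>+x. A n x \<partial>R) \<longlonglongrightarrow> k * (\<integral>\<^sup>+x. ennreal (h x) \<partial>R)"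
    if "finite_measure R" and [measurable_cong]: "sets R = sets borel" for R
  proof -
    have "(\<lambda>n. \<integral>\<^sup>+x. A n x \<partial>R) \<longlonglongrightarrow> (\<integral>\<^sup>+x. k * ennreal (h x) \<partial>R)"
      using A_le A_lim finite_measure.emeasure_finite[OF that(1), of "space R"]
      by (intro nn_integral_dominated_convergence[where w="\<lambda>_. k"])
         (auto simp: k less_top ennreal_mult_less_top)
    then show ?thesis by (simp add: nn_integral_cmult)
  qed
  have "k * (\<integral>\<^sup>+x. ennreal (h x) \<partial>P) = k * (\<integral>\<^sup>+x. ennreal (h x) \<partial>Q)"
    by (rule LIMSEQ_unique[OF conv[OF P, unfolded A_eq] conv[OF Q]])
  then show "(\<integral>\<^sup>+x. ennreal (h x) \<partial>P) = (\<integral>\<^sup>+x. ennreal (h x) \<partial>Q)"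
    by (simp add: k ennreal_mult_cancel_left)
qed

text \<open>The components are separated one at a time. With the first feature as a weight, the
  features of the second component determine a finite measure there and may be replaced by
  indicators; with such an indicator as weight, the first component is treated in the same way.
  Rectangles then determine the joint measure.\<close>

lemma prob_space_pair_eqI_gauss_feature:
  fixes P Q :: "('a::euclidean_space \<times> 'b::euclidean_space) measure"
  assumes "0 < C"
    and P: "prob_space P" "sets P = sets (borel \<Otimes>\<^sub>M borel)"
    and Q: "prob_space Q" "sets Q = sets (borel \<Otimes>\<^sub>M borel)"
    and eq: "AE \<theta> in imq_feature_measure C \<Otimes>\<^sub>M imq_feature_measure C.
      (\<integral>\<^sup>+p. ennreal (gauss_feature (fst p) (fst \<theta>) * gauss_feature (snd p) (snd \<theta>)) \<partial>P) =
      (\<integral>\<^sup>+p. ennreal (gauss_feature (fst p) (fst \<theta>) * gauss_feature (snd p) (snd \<theta>)) \<partial>Q)"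
  shows "P = Q"
proof -
  let ?L1 = "imq_feature_measure C :: (real \<times> 'a) measure"
  let ?L2 = "imq_feature_measure C :: (real \<times> 'b) measure"
  note [measurable_cong] = P(2) Q(2)
  interpret pair_sigma_finite ?L1 ?L2
    by (simp add: pair_sigma_finite_def sigma_finite_imq_feature_measure)
  \<comment> \<open>Weighting destroys the total mass 1, but weights bounded by 1 keep the projected
    measures finite, as the uniqueness lemma requires.\<close>
  have fin: "finite_measure (distr (density R w) borel v)"
    if R: "prob_space R" and [measurable]: "w \<in> borel_measurable R" "v \<in> R \<rightarrow>\<^sub>M borel" and w: "\<And>p. w p \<le> 1"
    for R :: "('a \<times> 'b) measure" and w and v :: "'a \<times> 'b \<Rightarrow> 'c::topological_space"
  proof
    interpret R: prob_space R by fact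
    have "emeasure (distr (density R w) borel v) (space (distr (density R w) borel v)) =
        (\<integral>\<^sup>+p. w p * indicator (v -` UNIV \<inter> space R) p \<partial>R)"
      by (simp add: emeasure_distr emeasure_density)
    also have "\<dots> \<le> (\<integral>\<^sup>+p. 1 \<partial>R)"
      using w by (intro nn_integral_mono) (auto simp: indicator_def)
    also have "\<dots> = 1" by (simp add: R.emeasure_space_1)
    finally show "emeasure (distr (density R w) borel v) (space (distr (density R w) borel v)) \<noteq> \<infinity>"
      by (auto simp: top_unique)
  qed
  have first: "(\<integral>\<^sup>+p. ennreal (gauss_feature (fst p) \<theta>) * indicator B (snd p) \<partial>P) =
      (\<integral>\<^sup>+p. ennreal (gauss_feature (fst p) \<theta>) * indicator B (snd p) \<partial>Q)"
    if ae: "AE \<theta>' in ?L2. (\<integral>\<^sup>+p. ennreal (gauss_feature (fst p) \<theta> * gauss_feature (snd p) \<theta>') \<partial>P) =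
      (\<integral>\<^sup>+p. ennreal (gauss_feature (fst p) \<theta> * gauss_feature (snd p) \<theta>') \<partial>Q)"
      and [measurable]: "B \<in> sets borel"
    for \<theta> and B :: "'b set"
  proof -
    \<comment> \<open>The first feature, at fixed parameter, is absorbed into the measure, so that
      joint feature means become ordinary feature means on the second component.\<close>
    define D where "D R = distr (density R (\<lambda>p. ennreal (gauss_feature (fst p) \<theta>))) borel snd"
      for R :: "('a \<times> 'b) measure"
    have D_int: "(\<integral>\<^sup>+y. ennreal (gauss_feature y \<theta>') \<partial>D R) =
        (\<integral>\<^sup>+p. ennreal (gauss_feature (fst p) \<theta> * gauss_feature (snd p) \<theta>') \<partial>R)"
      if [measurable_cong]: "sets R = sets (borel \<Otimes>\<^sub>M borel)" for R \<theta>'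
      unfolding D_def by (subst nn_integral_distr) (simp_all add: nn_integral_density ennreal_mult)
    have D_em: "emeasure (D R) B = (\<integral>\<^sup>+p. ennreal (gauss_feature (fst p) \<theta>) * indicator B (snd p) \<partial>R)"
      if [measurable_cong]: "sets R = sets (borel \<Otimes>\<^sub>M borel)" for R
      unfolding D_def
      by (subst nn_integral_indicator[symmetric])
         (simp_all add: nn_integral_distr nn_integral_density del: nn_integral_indicator)
    have "D P = D Q"
    proof (rule finite_measure_eqI_gauss_feature)
      show "finite_measure (D P)" "finite_measure (D Q)"
        unfolding D_def using P(1) Q(1) by (auto intro!: fin)
      show "AE \<theta>' in lborel \<Otimes>\<^sub>M lborel. 0 < fst \<theta>' \<longrightarrow>
          (\<integral>\<^sup>+y. ennreal (gauss_feature y \<theta>') \<partial>D P) = (\<integral>\<^sup>+y. ennreal (gauss_feature y \<theta>') \<partial>D Q)"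
        using ae \<open>0 < C\<close> unfolding D_int[OF P(2)] D_int[OF Q(2)]
        by (intro AE_imq_feature_measure)
    qed (simp_all add: D_def)
    then show ?thesis using D_em[OF P(2)] D_em[OF Q(2)] by simp
  qed
  have rect: "emeasure P (A \<times> B) = emeasure Q (A \<times> B)"
    if [measurable]: "A \<in> sets borel" "B \<in> sets borel" for A B
  proof -
    \<comment> \<open>The roles are exchanged: the weight is now the indicator of \<open>B\<close>,
      and the measure lives on the first component.\<close>
    define D where "D R = distr (density R (\<lambda>p. indicator B (snd p))) borel fst"
      for R :: "('a \<times> 'b) measure"
    have D_int: "(\<integral>\<^sup>+x. ennreal (gauss_feature x \<theta>) \<partial>D R) =
        (\<integral>\<^sup>+p. ennreal (gauss_feature (fst p) \<theta>) * indicator B (snd p) \<partial>R)"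
      if [measurable_cong]: "sets R = sets (borel \<Otimes>\<^sub>M borel)" for R \<theta>
      unfolding D_def by (simp add: nn_integral_distr nn_integral_density mult.commute)
    have D_em: "emeasure (D R) A = emeasure R (A \<times> B)"
      if [measurable_cong]: "sets R = sets (borel \<Otimes>\<^sub>M borel)" for R
    proof -
      have "emeasure (D R) A = (\<integral>\<^sup>+p. indicator B (snd p) * indicator A (fst p) \<partial>R)"
        unfolding D_def
        by (subst nn_integral_indicator[symmetric])
           (simp_all add: nn_integral_distr nn_integral_density del: nn_integral_indicator)
      also have "\<dots> = (\<integral>\<^sup>+p. indicator (A \<times> B) p \<partial>R)"
        by (intro nn_integral_cong) (auto simp: indicator_def)
      also have "\<dots> = emeasure R (A \<times> B)"
        by (rule nn_integral_indicator) measurable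
      finally show ?thesis .
    qed
    have "D P = D Q"
    proof (rule finite_measure_eqI_gauss_feature)
      show "finite_measure (D P)" "finite_measure (D Q)"
        unfolding D_def using P(1) Q(1) by (auto intro!: fin simp: indicator_def)
      have "AE \<theta> in ?L1. (\<integral>\<^sup>+x. ennreal (gauss_feature x \<theta>) \<partial>D P) = (\<integral>\<^sup>+x. ennreal (gauss_feature x \<theta>) \<partial>D Q)"
        \<comment> \<open>For almost every first parameter the means agree for almost every second
          parameter, which is the premise of \<open>first\<close>.\<close>
        using AE_pair[OF eq] unfolding D_int[OF P(2)] D_int[OF Q(2)]
        by eventually_elim (intro first, simp_all)
      then show "AE \<theta> in lborel \<Otimes>\<^sub>M lborel. 0 < fst \<theta> \<longrightarrow>
          (\<integral>\<^sup>+x. ennreal (gauss_feature x \<theta>) \<partial>D P) = (\<integral>\<^sup>+x. ennreal (gauss_feature x \<theta>) \<partial>D Q)"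
        using \<open>0 < C\<close> by (intro AE_imq_feature_measure)
    qed (simp_all add: D_def)
    then show ?thesis using D_em[OF P(2)] D_em[OF Q(2)] by simp
  qed
  show ?thesis
  proof (rule measure_eqI_generator_eq[OF Int_stable_pair_measure_generator[of borel borel]])
    let ?E = "{A \<times> B | A B. A \<in> sets (borel :: 'a measure) \<and> B \<in> sets (borel :: 'b measure)}"
    show "?E \<subseteq> Pow UNIV" by simp
    show "sets P = sigma_sets UNIV ?E" "sets Q = sigma_sets UNIV ?E"
      using P Q by (simp_all add: sets_pair_measure)
    show "range (\<lambda>_::nat. UNIV :: ('a \<times> 'b) set) \<subseteq> ?E"
      by (auto intro!: exI[of _ UNIV])
    show "(\<Union>i::nat. UNIV :: ('a \<times> 'b) set) = UNIV" by simp
    show "emeasure P UNIV \<noteq> \<infinity>" for i :: nat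
      using finite_measure.emeasure_finite[OF prob_space.finite_measure[OF P(1)]] by simp
    show "emeasure P X = emeasure Q X" if "X \<in> ?E" for X
      using that rect by auto
  qed
qed

section \<open>The product kernel separates probability measures\<close>

lemma imq_kernel_measurable[measurable (raw)]:
  fixes u v :: "'n \<Rightarrow> 'a::euclidean_space"
  assumes [measurable]: "u \<in> borel_measurable N" "v \<in> borel_measurable N"
  shows "(\<lambda>x. imq_kernel C (u x) (v x)) \<in> borel_measurable N"
  unfolding imq_kernel_def by measurable

lemma imq_kernel_bounds:
  assumes "0 < C"
  shows "0 \<le> imq_kernel C x y" "imq_kernel C x y \<le> 1"
  using assms by (simp_all add: imq_kernel_def divide_le_eq add_pos_nonneg)

text \<open>Products of features, integrated over the product of the two feature measures, represent
  the product kernel. A vanishing MMD thus makes all product feature means agree almost everywhere,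
  and these determine the joint measure.\<close>

lemma mmd2_pair_kernel_eq_0_imp_eq:
  fixes P Q :: "('a::euclidean_space \<times> 'b::euclidean_space) measure"
  assumes "0 < C"
    and P: "prob_space P" "sets P = sets (borel \<Otimes>\<^sub>M borel)"
    and Q: "prob_space Q" "sets Q = sets (borel \<Otimes>\<^sub>M borel)"
    and zero: "mmd2 (pair_kernel C) P Q = 0"
  shows "P = Q"
proof (rule prob_space_pair_eqI_gauss_feature[OF \<open>0 < C\<close> P Q])
  let ?L1 = "imq_feature_measure C :: (real \<times> 'a) measure"
  let ?L2 = "imq_feature_measure C :: (real \<times> 'b) measure"
  interpret L2: sigma_finite_measure ?L2 by (rule sigma_finite_imq_feature_measure)
  interpret pair_sigma_finite ?L1 ?L2
    by (simp add: pair_sigma_finite_def sigma_finite_imq_feature_measure)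
  show "AE \<theta> in ?L1 \<Otimes>\<^sub>M ?L2.
      (\<integral>\<^sup>+p. ennreal (gauss_feature (fst p) (fst \<theta>) * gauss_feature (snd p) (snd \<theta>)) \<partial>P) =
      (\<integral>\<^sup>+p. ennreal (gauss_feature (fst p) (fst \<theta>) * gauss_feature (snd p) (snd \<theta>)) \<partial>Q)"
  proof (rule mmd2_eq_0_imp_features_eq[OF P(1) Q(1) _ P(2) Q(2) _ _ _ _ _ _ _ zero])
    show "sigma_finite_measure (?L1 \<Otimes>\<^sub>M ?L2)" ..
    show "(\<lambda>p. gauss_feature (fst (fst p)) (fst (snd p)) * gauss_feature (snd (fst p)) (snd (snd p)))
        \<in> borel_measurable ((borel \<Otimes>\<^sub>M borel) \<Otimes>\<^sub>M (?L1 \<Otimes>\<^sub>M ?L2))"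
      by measurable
    show "(\<lambda>p. pair_kernel C (fst p) (snd p)) \<in>
        borel_measurable ((borel \<Otimes>\<^sub>M borel) \<Otimes>\<^sub>M (borel \<Otimes>\<^sub>M borel) ::
          (('a \<times> 'b) \<times> ('a \<times> 'b)) measure)"
      unfolding pair_kernel_def by measurable
    show "0 \<le> pair_kernel C x y" "pair_kernel C x y \<le> 1" for x y :: "'a \<times> 'b"
      by (auto simp: pair_kernel_def imq_kernel_bounds[OF \<open>0 < C\<close>] intro!: mult_le_one)
    show "(\<integral>\<^sup>+\<theta>. ennreal (gauss_feature (fst x) (fst \<theta>) * gauss_feature (snd x) (snd \<theta>) *
        (gauss_feature (fst y) (fst \<theta>) * gauss_feature (snd y) (snd \<theta>))) \<partial>(?L1 \<Otimes>\<^sub>M ?L2)) =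
        ennreal (pair_kernel C x y)" for x y
    proof -
      have "(\<integral>\<^sup>+\<theta>. ennreal (gauss_feature (fst x) (fst \<theta>) * gauss_feature (snd x) (snd \<theta>) *
          (gauss_feature (fst y) (fst \<theta>) * gauss_feature (snd y) (snd \<theta>))) \<partial>(?L1 \<Otimes>\<^sub>M ?L2)) =
        (\<integral>\<^sup>+\<theta>. ennreal (gauss_feature (fst x) (fst \<theta>) * gauss_feature (fst y) (fst \<theta>)) *
          ennreal (gauss_feature (snd x) (snd \<theta>) * gauss_feature (snd y) (snd \<theta>)) \<partial>(?L1 \<Otimes>\<^sub>M ?L2))"
        \<comment> \<open>The four features are regrouped by component, so that the double integral
          splits into two kernel representations.\<close>
        by (intro nn_integral_cong) (simp add: ennreal_mult[symmetric] mult_ac)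
      also have "\<dots> = (\<integral>\<^sup>+\<theta>. \<integral>\<^sup>+\<theta>'. ennreal (gauss_feature (fst x) \<theta> * gauss_feature (fst y) \<theta>) *
          ennreal (gauss_feature (snd x) \<theta>' * gauss_feature (snd y) \<theta>') \<partial>?L2 \<partial>?L1)"
        by (subst L2.nn_integral_fst[symmetric]) simp_all
      also have "\<dots> = ennreal (imq_kernel C (fst x) (fst y)) * ennreal (imq_kernel C (snd x) (snd y))"
        using \<open>0 < C\<close> by (simp add: nn_integral_cmult nn_integral_multc nn_integral_imq_feature)
      finally show ?thesis
        by (simp add: pair_kernel_def ennreal_mult imq_kernel_bounds[OF \<open>0 < C\<close>])
    qed
  qed (auto intro: mult_le_one)
qed

section \<open>Invertible networks are homeomorphisms\<close>

lemma continuous_on_split_vec: "continuous_on UNIV split_vec"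
  unfolding split_vec_def[abs_def] by (intro continuous_intros)

lemma continuous_on_join_vec: "continuous_on UNIV join_vec"
  unfolding join_vec_def[abs_def]
proof (rule continuous_on_vec_lambda)
  show "continuous_on UNIV (\<lambda>p. case k of Inl i \<Rightarrow> fst p $ i | Inr j \<Rightarrow> snd p $ j)"
    for k :: "'a + 'b"
    by (cases k) (auto intro!: continuous_intros)
qed

lemma continuous_on_permute_vec: "continuous_on UNIV (permute_vec s)"
  unfolding permute_vec_def[abs_def] by (intro continuous_intros)

lemma homeomorphism_split_vec: "homeomorphism UNIV UNIV split_vec join_vec"
proof (rule homeomorphismI)
  show "join_vec (split_vec x) = x" "split_vec (join_vec p) = p"
    for x :: "real ^ ('a + 'b)" and p :: "(real ^ 'a) \<times> (real ^ 'b)"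
    by (auto simp: split_vec_def join_vec_def vec_eq_iff split: sum.split)
qed (simp_all add: continuous_on_split_vec continuous_on_join_vec)

lemmas homeomorphism_join_vec = homeomorphism_symD[OF homeomorphism_split_vec]

lemma homeomorphism_permute_vec:
  assumes "bij s"
  shows "homeomorphism UNIV UNIV (permute_vec s) (permute_vec (inv s))"
proof (rule homeomorphismI)
  show "permute_vec (inv s) (permute_vec s x) = x" "permute_vec s (permute_vec (inv s) x) = x" for x
    using assms by (simp_all add: permute_vec_def vec_eq_iff bij_is_surj surj_f_inv_f bij_is_inj)
qed (simp_all add: continuous_on_permute_vec)

text \<open>The first output is the very argument of \<rho> and \<eta>, so the second input is
  recovered by dividing by a nonvanishing exponential; \<phi> of it is then subtracted from the
  first output. Only continuity of the subnetworks enters.\<close>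

lemma homeomorphism_inn_block:
  fixes \<phi> :: "real ^ 'r::finite \<Rightarrow> real ^ 'm::finite"
  assumes [continuous_intros]: "continuous_on UNIV \<phi>" "continuous_on UNIV \<rho>" "continuous_on UNIV \<eta>"
  shows "\<exists>g. homeomorphism UNIV UNIV (inn_block \<phi> \<rho> \<eta>) g"
proof -
  let ?h = "\<lambda>y. \<chi> j. (snd y $ j - \<eta> (fst y) $ j) / exp (\<rho> (fst y) $ j)"
  let ?g = "\<lambda>y. (fst y - \<phi> (?h y), ?h y)"
  note [continuous_intros] = continuous_on_compose2[OF assms(1)] continuous_on_compose2[OF assms(2)]
    continuous_on_compose2[OF assms(3)]
  have "homeomorphism UNIV UNIV (inn_block \<phi> \<rho> \<eta>) ?g"
  proof (rule homeomorphismI)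
    show "continuous_on UNIV (inn_block \<phi> \<rho> \<eta>)"
      unfolding inn_block_def Let_def split_beta' by (intro continuous_intros) simp_all
    show "continuous_on UNIV ?g"
      by (intro continuous_intros) simp_all
  qed (auto simp: inn_block_def Let_def vec_eq_iff split_beta prod_eq_iff)
  then show ?thesis by blast
qed

lemma homeomorphism_linear:
  fixes A :: "'a::euclidean_space \<Rightarrow> 'a"
  assumes "linear A" "bij A"
  shows "homeomorphism UNIV UNIV A (inv A)"
proof (rule homeomorphismI)
  have "linear (inv A)"
    using assms by (simp add: inj_linear_imp_inv_linear bij_is_inj)
  then show "continuous_on UNIV (inv A)" by (rule linear_continuous_on[OF linear_conv_bounded_linear[THEN iffD1]])
  show "continuous_on UNIV A" using assms by (intro linear_continuous_on linear_conv_bounded_linear[THEN iffD1])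
qed (use assms in \<open>simp_all add: bij_is_inj bij_is_surj surj_f_inv_f\<close>)

text \<open>Each constituent of a network is a homeomorphism, and these compose. The induction
  carries an unspecified inverse, which is identified with \<open>inv f\<close> at the end by
  uniqueness.\<close>

lemma inn_homeomorphism:
  assumes "inn f"
  shows "homeomorphism UNIV UNIV f (inv f)"
proof -
  from assms have "\<exists>g. homeomorphism UNIV UNIV f g"
  proof induction
    case (linear A)
    then show ?case
      using homeomorphism_compose[OF homeomorphism_linear homeomorphism_split_vec] by blast
  next
    case (block F s \<phi> \<rho> \<eta>)
    obtain k where F: "homeomorphism UNIV UNIV F k" using block.IH by blast
    obtain l where l: "homeomorphism UNIV UNIV (inn_block \<phi> \<rho> \<eta>) l"
      using homeomorphism_inn_block block.hyps by blast
    show ?case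
      using homeomorphism_compose[OF homeomorphism_compose[OF homeomorphism_compose[OF
        homeomorphism_compose[OF F homeomorphism_join_vec] homeomorphism_permute_vec[OF \<open>bij s\<close>]]
        homeomorphism_split_vec] l]
      by (simp only: comp_assoc) blast
  qed
  then obtain g where g: "homeomorphism UNIV UNIV f g" ..
  then have "inv f = g"
    by (intro inv_equality) (auto simp: homeomorphism_def)
  with g show ?thesis by simp
qed

section \<open>Reconstruction\<close>

text \<open>The product rule for independent events gives the joint law on rectangles, and
  rectangles characterize the product measure.\<close>

lemma distr_Pair_indep_rv:
  assumes S: "prob_space S" and indep: "indep_rv S MX X MY Y"
  shows "distr S (MX \<Otimes>\<^sub>M MY) (\<lambda>\<omega>. (X \<omega>, Y \<omega>)) = distr S MX X \<Otimes>\<^sub>M distr S MY Y"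
proof (rule pair_measure_eqI[symmetric])
  interpret S: prob_space S by fact
  have [measurable]: "X \<in> S \<rightarrow>\<^sub>M MX" "Y \<in> S \<rightarrow>\<^sub>M MY"
    using indep by (simp_all add: indep_rv_def)
  show "sigma_finite_measure (distr S MX X)" "sigma_finite_measure (distr S MY Y)"
    by (auto intro!: prob_space_imp_sigma_finite S.prob_space_distr)
  fix A B assume "A \<in> sets (distr S MX X)" "B \<in> sets (distr S MY Y)"
  then have [measurable]: "A \<in> sets MX" "B \<in> sets MY" by simp_all
  have "S.prob ((X -` A \<inter> space S) \<inter> (Y -` B \<inter> space S)) =
      S.prob (X -` A \<inter> space S) * S.prob (Y -` B \<inter> space S)"
    using indep unfolding indep_rv_def by (intro S.indep_setD) auto
  moreover have "(\<lambda>\<omega>. (X \<omega>, Y \<omega>)) -` (A \<times> B) \<inter> space S = (X -` A \<inter> space S) \<inter> (Y -` B \<inter> space S)"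
    by auto
  ultimately show "emeasure (distr S MX X) A * emeasure (distr S MY Y) B =
      emeasure (distr S (MX \<Otimes>\<^sub>M MY) (\<lambda>\<omega>. (X \<omega>, Y \<omega>))) (A \<times> B)"
    by (simp add: emeasure_distr S.emeasure_eq_measure ennreal_mult)
qed simp

theorem theorem3:
  fixes pH :: "(real ^ ('m::finite + 'r::finite)) measure"
    and f :: "real ^ ('m + 'r) \<Rightarrow> (real ^ 'm) \<times> (real ^ 'r)"
    and g :: "(real ^ 'm) \<times> (real ^ 'r) \<Rightarrow> real ^ ('m + 'r)"
    and B Q :: nat
    and T \<beta> \<tau> \<sigma> C :: real
    and a b :: "nat \<Rightarrow> real ^ 'm" and c :: "real ^ 'm"
    and V :: "nat \<Rightarrow> real ^ 'm"
    and P :: "nat \<Rightarrow> nat \<Rightarrow> real"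
    and \<Psi> :: "real ^ 'm \<Rightarrow> real ^ 'm"
    and \<mu> :: "real ^ 'r"
    and S :: "'s measure"
    and H H' :: "'s \<Rightarrow> real ^ ('m + 'r)"
    and u :: "'m \<times> nat \<Rightarrow> 's \<Rightarrow> real"
    and zhat :: "'s \<Rightarrow> real ^ 'm" and r :: "'s \<Rightarrow> real ^ 'r"
  assumes prior: "prob_space pH" "sets pH = sets borel"
    and inn: "inn f" and inverse: "g = inv f"
    and bits: "1 \<le> B" "Q = 2 ^ B"
    and daq_temp: "0 < T"
    and a_nonneg: "\<And>q i. q \<in> {1..Q - 1} \<Longrightarrow> 0 \<le> a q $ i"
    and b_mono: "\<And>q q' i. 1 \<le> q \<Longrightarrow> q \<le> q' \<Longrightarrow> q' \<le> Q - 1 \<Longrightarrow> b q $ i \<le> b q' $ i"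
    and points: "V = quant_points Q a c"
    and dbcd_params: "0 < \<beta>" "0 < \<tau>" "channel_matrix Q P"
    and denoiser: "continuous_on UNIV \<Psi>"
    and sigma: "0 < \<sigma>"
    and kernel_const: "0 < C"
    and prob_space: "prob_space S"
    and H: "H \<in> borel_measurable S" "distr S borel H = pH"
    and u_uniform: "\<And>k. k \<in> UNIV \<times> {1..Q} \<Longrightarrow>
      distr S borel (u k) = uniform_measure lborel {0<..<1}"
    and u_indep: "prob_space.indep_vars S (\<lambda>_. borel) u (UNIV \<times> {1..Q})"
    and H_u_indep: "indep_rv S borel H
      (PiM (UNIV \<times> {1..Q}) (\<lambda>_. borel)) (\<lambda>\<omega>. \<lambda>k\<in>UNIV \<times> {1..Q}. u k \<omega>)"
    and zhat: "\<And>\<omega>. zhat \<omega> =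
      \<Psi> (dbcd \<beta> \<tau> Q P (daq T Q a b c (fst (f (H \<omega>)))) V (\<lambda>k. u k \<omega>))"
    and r: "distr S borel r = gaussian \<mu> \<sigma>"
    and zhat_r_indep: "indep_rv S borel zhat borel r"
    and reconstruction: "\<And>\<omega>. H' \<omega> = g (zhat \<omega>, r \<omega>)"
    and loss_zero: "mmd2 (pair_kernel C) (distr pH borel f)
      (distr S borel zhat \<Otimes>\<^sub>M gaussian \<mu> \<sigma>) = 0"
  shows "mmd2 (imq_kernel C) (distr S borel H') pH = 0"
proof -
  interpret pH: prob_space pH by fact
  interpret S: prob_space S by fact
  let ?J = "distr S borel zhat \<Otimes>\<^sub>M gaussian \<mu> \<sigma>"
  \<comment> \<open>The definition of independence includes the measurability of both
    variables.\<close>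
  have rv: "zhat \<in> borel_measurable S" "r \<in> borel_measurable S"
    using zhat_r_indep by (simp_all add: indep_rv_def)
  note [measurable_cong] = prior(2)
  have "homeomorphism UNIV UNIV f g"
    using inn_homeomorphism[OF inn] inverse by simp
  then have [measurable]: "f \<in> borel \<rightarrow>\<^sub>M borel" "g \<in> borel \<rightarrow>\<^sub>M borel" and gf: "g (f x) = x" for x
    by (auto simp: homeomorphism_def intro!: borel_measurable_continuous_onI)
  \<comment> \<open>Independence identifies the target of the loss with the actual law of the
    decoder input.\<close>
  have joint: "distr S borel (\<lambda>\<omega>. (zhat \<omega>, r \<omega>)) = ?J"
    using distr_Pair_indep_rv[OF prob_space zhat_r_indep] by (simp add: r borel_prod)
  have "distr pH borel f = ?J"
  proof (rule mmd2_pair_kernel_eq_0_imp_eq[OF kernel_const _ _ _ _ loss_zero])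
    show "prob_space (distr pH borel f)" by (rule pH.prob_space_distr) measurable
    \<comment> \<open>As the law of a pair of random variables the product has total mass 1; no
      Gaussian integral is computed.\<close>
    show "prob_space ?J"
      unfolding joint[symmetric] by (rule S.prob_space_distr) (use rv in measurable)
    show "sets ?J = sets (borel \<Otimes>\<^sub>M borel)"
      by (rule sets_pair_measure_cong) (simp_all add: gaussian_def)
  qed (simp only: sets_distr borel_prod)
  then have dist: "distr S borel (\<lambda>\<omega>. (zhat \<omega>, r \<omega>)) = distr pH borel f"
    using joint by simp
  \<comment> \<open>The equality of laws is pushed forward along \<open>g\<close>; on the side of
    the prior, \<open>g\<close> undoes \<open>f\<close>.\<close>
  have "distr S borel H' = distr (distr S borel (\<lambda>\<omega>. (zhat \<omega>, r \<omega>))) borel g"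
    using rv by (subst distr_distr) (simp_all add: comp_def reconstruction[abs_def])
  also have "\<dots> = distr (distr pH borel f) borel g"
    unfolding dist ..
  also have "\<dots> = distr pH borel (\<lambda>x. x)"
    by (subst distr_distr) (simp_all add: comp_def gf)
  also have "\<dots> = pH"
    by (rule distr_id2) (simp add: prior(2))
  \<comment> \<open>The two laws coincide, so the three terms of the MMD cancel.\<close>
  finally show ?thesis by (simp add: mmd2_def)
qed

end
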